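(* Let $S$, $Y$, $\hat Z$ be random variables forming a Markov chain $Y\leftrightarrow S\leftrightarrow\hat Z$, with joint law $p(s,y)$ of $(S,Y)$ and conditional law $p_\theta(\hat z\mid s)$ of $\hat Z$ given $S=s$. Let $$\mathcal{L}_{IB}=-I(\hat Z;Y)+\beta I(\hat Z;S).$$ Let $q(\hat z)$ be a variational approximation of the marginal $p(\hat z)=\int p(s)p_\theta(\hat z\mid s)\,ds$, and let $q_\phi(y\mid\hat z)$ be a variational approximation of the conditional $p(y\mid\hat z)=\int \frac{p(y\mid s)p_\theta(\hat z\mid s)p(s)}{p(\hat z)}\,ds$. Then $$\overline{\mathcal{L}}_{VIB}=\mathbb{E}_{p(s,y)}\Big\{\mathbb{E}_{p_\theta(\hat z\mid s)}\big[-\log q_\phi(y\mid\hat z)\big]+\beta\,KL\big(p_\theta(\hat z\mid s)\,\|\,q(\hat z)\big)\Big\}$$ is a variational upper bound for $\mathcal{L}_{IB}$, that is, $\mathcal{L}_{IB}\le\overline{\mathcal{L}}_{VIB}$.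
   Context: $I(\cdot;\cdot)$ is mutual information and $KL(\cdot\|\cdot)$ is the Kullback-Leibler divergence. $S$ (with realizations $s\in\mathbb{R}^n$) is the input of a task-oriented semantic communication system, $Y$ (realizations $y$) is the target of the inference task, and $\hat Z$ (realizations $\hat z\in\mathbb{C}^k$) is the received signal. Its conditional law $p_\theta(\hat z\mid s)$ is determined by the encoding distribution $p_\theta(z\mid s)$ of the transmitted symbols $z$ and the channel model $p_{channel}(\hat z\mid z)$. All laws are written as densities, with sums over $y$ written as integrals $dy$. The symbols $\theta$ and $\phi$ are the parameter sets of the transmitter (encoding) network and of the task inference network at the receiver, and $\beta$ is the weight in the information bottleneck loss $\mathcal{L}_{IB}$. In deriving the bound, the entropy $H(Y)$ appearing in $I(\hat Z;Y)=\int p(\hat z)p(y\mid\hat z)\log p(y\mid\hat z)\,dy\,d\hat z+H(Y)$ is treated as a constant, depending only on the input data, and is dropped.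
   Formalization: The literal bound is proved for discrete Y; for general Y, where it fails if H(Y) is negative, the dropped constant is restored: L_IB + H(Y) ≤ the variational bound, assuming H(Y) and I(Ẑ;Y) are finite; β is taken nonnegative. *)

theory Defs
  imports "HOL-Probability.Probability"
begin

definition prob_density :: "'a measure \<Rightarrow> ('a \<Rightarrow> real) \<Rightarrow> bool" where
  "prob_density \<mu> f \<longleftrightarrow>
    f \<in> borel_measurable \<mu> \<and> (\<forall>x\<in>space \<mu>. 0 \<le> f x) \<and> (\<integral>\<^sup>+ x. ennreal (f x) \<partial>\<mu>) = 1"

definition density_kernel :: "'a measure \<Rightarrow> 'b measure \<Rightarrow> ('a \<Rightarrow> 'b \<Rightarrow> real) \<Rightarrow> bool" where
  "density_kernel A \<mu> k \<longleftrightarrow>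
    (\<lambda>(x, y). k x y) \<in> borel_measurable (A \<Otimes>\<^sub>M \<mu>) \<and> (\<forall>x\<in>space A. prob_density \<mu> (k x))"

text \<open>The conditional law of \<open>Z\<close> given \<open>X = x\<close> has the density \<open>k x\<close> with respect to \<open>\<mu>\<close>.\<close>

definition has_cond_density ::
  "'w measure \<Rightarrow> 'a measure \<Rightarrow> 'b measure \<Rightarrow> ('w \<Rightarrow> 'a) \<Rightarrow> ('w \<Rightarrow> 'b) \<Rightarrow> ('a \<Rightarrow> 'b \<Rightarrow> real) \<Rightarrow> bool" where
  "has_cond_density M A \<mu> X Z k \<longleftrightarrow>
    density_kernel A \<mu> k \<and>
    distr M (A \<Otimes>\<^sub>M \<mu>) (\<lambda>\<omega>. (X \<omega>, Z \<omega>)) =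
      density (distr M A X \<Otimes>\<^sub>M \<mu>) (\<lambda>(x, z). ennreal (k x z))"

text \<open>\<open>X \<leftrightarrow> Y \<leftrightarrow> Z\<close>: for every event \<open>D\<close>, \<open>P (Z \<in> D | X, Y) = P (Z \<in> D | Y)\<close> almost surely.\<close>

definition markov_chain ::
  "'w measure \<Rightarrow> 'a measure \<Rightarrow> 'b measure \<Rightarrow> 'c measure \<Rightarrow>
   ('w \<Rightarrow> 'a) \<Rightarrow> ('w \<Rightarrow> 'b) \<Rightarrow> ('w \<Rightarrow> 'c) \<Rightarrow> bool" where
  "markov_chain M A B C X Y Z \<longleftrightarrow>
    (\<forall>D\<in>sets C. AE \<omega> in M.
      real_cond_exp M (vimage_algebra (space M) (\<lambda>\<omega>. (X \<omega>, Y \<omega>)) (A \<Otimes>\<^sub>M B))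
        (indicator (Z -` D \<inter> space M)) \<omega> =
      real_cond_exp M (vimage_algebra (space M) Y B)
        (indicator (Z -` D \<inter> space M)) \<omega>)"

text \<open>
  \<open>KL(P || Q)\<close> for probability measures \<open>P\<close>, \<open>Q\<close>; the library's \<open>KL_divergence\<close> takes its
  arguments in the opposite order and is real-valued.  The negative part of the log-density
  is always integrable under \<open>P\<close>, so if the log-density is not integrable, its integral is \<open>\<infinity>\<close>.
\<close>

definition kl :: "real \<Rightarrow> 'a measure \<Rightarrow> 'a measure \<Rightarrow> ereal" where
  "kl b P Q =
    (if absolutely_continuous Q P \<and> integrable P (entropy_density b Q P)
     then ereal (KL_divergence b Q P) else \<infinity>)"

definition mutual_info ::
  "real \<Rightarrow> 'w measure \<Rightarrow> 'a measure \<Rightarrow> 'b measure \<Rightarrow> ('w \<Rightarrow> 'a) \<Rightarrow> ('w \<Rightarrow> 'b) \<Rightarrow> ereal" where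
  "mutual_info b M A B X Y =
    kl b (distr M (A \<Otimes>\<^sub>M B) (\<lambda>\<omega>. (X \<omega>, Y \<omega>))) (distr M A X \<Otimes>\<^sub>M distr M B Y)"

text \<open>
  The integral of an extended-real function, \<open>\<integral> f\<^sup>+ - \<integral> f\<^sup>-\<close> (\<open>e2ennreal\<close> sends negative
  values to \<open>0\<close>).  If both parts are infinite the value is \<open>\<infinity>\<close>, because \<open>\<infinity> - \<infinity> = \<infinity>\<close> in \<open>ereal\<close>.
\<close>

definition ext_integral :: "'a measure \<Rightarrow> ('a \<Rightarrow> ereal) \<Rightarrow> ereal" where
  "ext_integral M f =
    enn2ereal (\<integral>\<^sup>+ x. e2ennreal (f x) \<partial>M) - enn2ereal (\<integral>\<^sup>+ x. e2ennreal (- f x) \<partial>M)"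

text \<open>\<open>- log 0 = \<infinity>\<close>, whereas \<open>log b 0 = 0\<close> in the library.\<close>

definition neg_log :: "real \<Rightarrow> real \<Rightarrow> ereal" where
  "neg_log b x = (if x = 0 then \<infinity> else ereal (- log b x))"

definition IB_loss ::
  "real \<Rightarrow> 'w measure \<Rightarrow> 's measure \<Rightarrow> 'y measure \<Rightarrow> 'z measure \<Rightarrow>
   ('w \<Rightarrow> 's) \<Rightarrow> ('w \<Rightarrow> 'y) \<Rightarrow> ('w \<Rightarrow> 'z) \<Rightarrow> real \<Rightarrow> ereal" where
  "IB_loss b M A B C S Y Z \<beta> =
    - mutual_info b M C B Z Y + ereal \<beta> * mutual_info b M C A Z S"

text \<open>
  Here \<open>p s z\<close>, \<open>q z\<close>, \<open>r z y\<close> are the densities \<open>p\<^sub>\<theta>(z | s)\<close>, \<open>q(z)\<close>, \<open>q\<^sub>\<phi>(y | z)\<close>.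
\<close>

definition VIB_loss ::
  "real \<Rightarrow> 'w measure \<Rightarrow> 's measure \<Rightarrow> 'y measure \<Rightarrow> 'z measure \<Rightarrow>
   ('w \<Rightarrow> 's) \<Rightarrow> ('w \<Rightarrow> 'y) \<Rightarrow> real \<Rightarrow>
   ('s \<Rightarrow> 'z \<Rightarrow> real) \<Rightarrow> ('z \<Rightarrow> real) \<Rightarrow> ('z \<Rightarrow> 'y \<Rightarrow> real) \<Rightarrow> ereal" where
  "VIB_loss b M A B C S Y \<beta> p q r =
    ext_integral (distr M (A \<Otimes>\<^sub>M B) (\<lambda>\<omega>. (S \<omega>, Y \<omega>)))
      (\<lambda>(s, y). ext_integral (density C (\<lambda>z. ennreal (p s z))) (\<lambda>z. neg_log b (r z y))
        + ereal \<beta> * kl b (density C (\<lambda>z. ennreal (p s z))) (density C (\<lambda>z. ennreal (q z))))"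

end

theory Submission
  imports Defs
begin

text \<open>
  Replacing \<open>q\<close> by the true marginal of \<open>Z\<close> can only decrease
  \<open>E KL (p\<^sub>\<theta> (\<cdot> | S) || q)\<close>, whose value at the marginal is \<open>I (Z; S)\<close>: written with the nonnegative
  integrand \<open>p log (p / q) + (q - p) / ln b\<close>, this already holds for each \<open>z\<close> separately, so that
  Tonelli's theorem applies without any integrability hypothesis.

  For the other term let \<open>g\<close> be the density of \<open>Y\<close> and \<open>h\<close> that of \<open>(Z, Y)\<close> with respect to the
  product of its marginals, so that the true \<open>p (y | z)\<close> is \<open>g h\<close>.  From \<open>ln t \<le> t - 1\<close> at
  \<open>t = q\<^sub>\<phi> / (g h)\<close>, the function \<open>- log q\<^sub>\<phi>\<close> is at least \<open>- log g - log h + (1 - q\<^sub>\<phi> / (g h)) / ln b\<close>,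
  which is integrable with integral at least \<open>H (Y) - I (Z; Y)\<close>; by the Markov property it may be
  integrated first over \<open>p\<^sub>\<theta> (\<cdot> | s)\<close> and then over \<open>(s, y)\<close>.  If \<open>Y\<close> is discrete,
  \<open>- log q\<^sub>\<phi> \<ge> 0 \<ge> - I (Z; Y)\<close>, and the minorant \<open>0\<close> suffices even when \<open>H (Y)\<close> is infinite.
\<close>

section \<open>Kullback-Leibler divergence of densities\<close>

text \<open>
  The term \<open>(g - f) / ln b\<close> integrates to \<open>0\<close> for probability densities and makes the integrand
  pointwise nonnegative.
\<close>

definition kl_integrand :: "real \<Rightarrow> real \<Rightarrow> real \<Rightarrow> ennreal" where
  "kl_integrand b f g =
    (if g = 0 \<and> f \<noteq> 0 then \<infinity> else ennreal (f * log b (f / g) + (g - f) / ln b))"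

lemma measurable_kl_integrand[measurable (raw)]:
  assumes [measurable]: "f \<in> borel_measurable N" "g \<in> borel_measurable N"
  shows "(\<lambda>x. kl_integrand b (f x) (g x)) \<in> borel_measurable N"
  unfolding kl_integrand_def by measurable

text \<open>This is \<open>ln t \<le> t - 1\<close> at \<open>t = g / f\<close>, multiplied by
  \<open>f\<close>. The case \<open>g = 0\<close>, \<open>f \<noteq> 0\<close> is excluded because
  there \<open>log b (f / 0) = log b 0 = 0\<close>, which would leave the negative value
  \<open>- f / ln b\<close>.\<close>

lemma kl_integrand_real_nonneg:
  assumes "1 < b" "0 \<le> f" "0 \<le> g" "g = 0 \<longrightarrow> f = 0"
  shows "0 \<le> f * log b (f / g) + (g - f) / ln b"
proof (cases "f = 0")
  case False
  then have "0 < f" "0 < g" using assms by (auto simp: less_le)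
  then have "ln (g / f) \<le> g / f - 1" by (intro ln_le_minus_one) simp
  then have "f * ln (g / f) \<le> g - f" using \<open>0 < f\<close> by (simp add: field_simps)
  then have "0 \<le> f * ln (f / g) + (g - f)"
    using \<open>0 < f\<close> \<open>0 < g\<close> by (simp add: ln_div algebra_simps)
  then have "0 \<le> (f * ln (f / g) + (g - f)) / ln b" using assms by simp
  then show ?thesis by (simp add: log_def add_divide_distrib)
qed (use assms in simp)

lemma prob_densityD:
  assumes "prob_density \<mu> f"
  shows "f \<in> borel_measurable \<mu>" "AE x in \<mu>. 0 \<le> f x" "integrable \<mu> f" "integral\<^sup>L \<mu> f = 1"
    "prob_space (density \<mu> f)"
proof -
  show [measurable]: "f \<in> borel_measurable \<mu>" and nn: "AE x in \<mu>. 0 \<le> f x"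
    using assms by (auto simp: prob_density_def)
  have 1: "(\<integral>\<^sup>+ x. ennreal (f x) \<partial>\<mu>) = 1" using assms by (simp add: prob_density_def)
  show "integrable \<mu> f" using nn 1 by (intro integrableI_nonneg) auto
  show "integral\<^sup>L \<mu> f = 1" using nn 1 by (subst integral_eq_nn_integral) auto
  show "prob_space (density \<mu> f)"
    using 1 by (intro prob_spaceI) (simp add: emeasure_density cong: nn_integral_cong)
qed

lemma prob_densityI:
  assumes [measurable]: "f \<in> borel_measurable \<mu>" and "\<And>x. x \<in> space \<mu> \<Longrightarrow> 0 \<le> f x"
    and "prob_space (density \<mu> f)"
  shows "prob_density \<mu> f"
proof -
  have "(\<integral>\<^sup>+ x. ennreal (f x) \<partial>\<mu>) = (\<integral>\<^sup>+ x. ennreal (f x) * indicator (space \<mu>) x \<partial>\<mu>)"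
    by (intro nn_integral_cong) simp
  also have "\<dots> = emeasure (density \<mu> f) (space (density \<mu> f))"
    by (simp add: emeasure_density)
  also have "\<dots> = 1" using assms(3) by (rule prob_space.emeasure_space_1)
  finally show ?thesis using assms by (simp add: prob_density_def)
qed

text \<open>The correction \<open>(g - f) / ln b\<close> integrates to \<open>0\<close>, so under
  absolute continuity finiteness of the nonnegative integral is the same as integrability of the
  log-density. If \<open>g = 0 < f\<close> on a set that is not null, both sides are
  \<open>\<infinity>\<close>.\<close>

lemma kl_density:
  assumes b: "1 < b" and f: "prob_density \<mu> f" and g: "prob_density \<mu> g"
  shows "kl b (density \<mu> f) (density \<mu> g) = enn2ereal (\<integral>\<^sup>+ x. kl_integrand b (f x) (g x) \<partial>\<mu>)"
proof -
  let ?P = "density \<mu> f" and ?Q = "density \<mu> g" and ?I = "\<integral>\<^sup>+ x. kl_integrand b (f x) (g x) \<partial>\<mu>"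
  note [measurable] = prob_densityD(1)[OF f] prob_densityD(1)[OF g]
  note fnn = prob_densityD(2)[OF f] and gnn = prob_densityD(2)[OF g]
  interpret P: prob_space ?P by (rule prob_densityD(5)[OF f])
  interpret Q: prob_space ?Q by (rule prob_densityD(5)[OF g])
  show ?thesis
  proof (cases "AE x in \<mu>. g x = 0 \<longrightarrow> f x = 0")
    case True
    \<comment> \<open>\<open>f / g\<close> is a Radon-Nikodym derivative of \<open>?P\<close> with
      respect to \<open>?Q\<close>; this gives absolute continuity and, by uniqueness, the
      log-density.\<close>
    have "density ?Q (\<lambda>x. ennreal (f x / g x)) = ?P"
      using fnn gnn True by (subst density_density_divide) auto
    moreover have "absolutely_continuous ?Q (density ?Q (\<lambda>x. ennreal (f x / g x)))"
      by (intro absolutely_continuousI_density) measurable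
    ultimately have ac: "absolutely_continuous ?Q ?P"
      and "AE x in ?Q. ennreal (f x / g x) = RN_deriv ?Q ?P x"
      by (auto intro: Q.RN_deriv_unique)
    then have "AE x in ?P. ennreal (f x / g x) = RN_deriv ?Q ?P x"
      by (intro absolutely_continuous_AE[OF _ ac]) auto
    moreover have "AE x in ?P. 0 \<le> f x / g x"
      using fnn gnn by (auto simp: AE_density)
    ultimately have eq: "AE x in ?P. entropy_density b ?Q ?P x = log b (f x / g x)"
      
    proof eventually_elim
      case (elim x)
      then have "f x / g x = enn2real (RN_deriv ?Q ?P x)"
        by (metis enn2real_ennreal)
      then show ?case by (simp add: entropy_density_def)
    qed
    have [measurable]: "entropy_density b ?Q ?P \<in> borel_measurable \<mu>"
      using measurable_entropy_density[of b ?Q ?P] by simp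
    have int_iff: "integrable ?P (entropy_density b ?Q ?P) \<longleftrightarrow>
        integrable \<mu> (\<lambda>x. f x * log b (f x / g x))"
      using fnn by (subst integrable_cong_AE[OF _ _ eq]) (auto simp: integrable_real_density)
    have kl_eq: "KL_divergence b ?Q ?P = (\<integral>x. f x * log b (f x / g x) \<partial>\<mu>)"
      unfolding KL_divergence_def using fnn
      by (subst integral_cong_AE[OF _ _ eq]) (auto intro!: integral_real_density)
    let ?D = "\<lambda>x. f x * log b (f x / g x) + (g x - f x) / ln b"
    have Dnn: "AE x in \<mu>. 0 \<le> ?D x"
      using True fnn gnn by eventually_elim (use kl_integrand_real_nonneg[OF b] in auto)
    have I: "?I = (\<integral>\<^sup>+ x. ennreal (?D x) \<partial>\<mu>)"
      using True by (intro nn_integral_cong_AE) (auto simp: kl_integrand_def)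
    have lin: "integrable \<mu> (\<lambda>x. (g x - f x) / ln b)" "(\<integral>x. (g x - f x) / ln b \<partial>\<mu>) = 0"
      using prob_densityD[OF f] prob_densityD[OF g] by auto
    have D_iff: "integrable \<mu> ?D \<longleftrightarrow> integrable \<mu> (\<lambda>x. f x * log b (f x / g x))"
    proof
      assume "integrable \<mu> ?D"
      from Bochner_Integration.integrable_diff[OF this lin(1)]
      show "integrable \<mu> (\<lambda>x. f x * log b (f x / g x))" by simp
    qed (use lin in auto)
    show ?thesis
    proof (cases "integrable \<mu> ?D")
      case int: True
      have "?I = ennreal (\<integral>x. ?D x \<partial>\<mu>)"
        unfolding I by (rule nn_integral_eq_integral[OF int Dnn])
      moreover have "(\<integral>x. ?D x \<partial>\<mu>) = (\<integral>x. f x * log b (f x / g x) \<partial>\<mu>)"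
        using int D_iff lin by (subst Bochner_Integration.integral_add) auto
      moreover have "0 \<le> (\<integral>x. ?D x \<partial>\<mu>)" using Dnn by (rule integral_nonneg_AE)
      ultimately show ?thesis
        using int D_iff int_iff ac by (simp add: kl_def kl_eq)
    next
      case False
      have "?I = \<infinity>"
      proof (rule ccontr)
        assume "?I \<noteq> \<infinity>"
        then have "integrable \<mu> ?D"
          unfolding I by (intro integrableI_nonneg[OF _ Dnn]) (measurable, simp add: less_top)
        with False show False ..
      qed
      then show ?thesis using False D_iff int_iff by (simp add: kl_def)
    qed
  next
    case False
    have "?I = \<infinity>"
    proof (rule ccontr)
      assume "?I \<noteq> \<infinity>"
      then have "AE x in \<mu>. kl_integrand b (f x) (g x) \<noteq> \<infinity>"
        by (intro nn_integral_PInf_AE) auto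
      then have "AE x in \<mu>. g x = 0 \<longrightarrow> f x = 0"
        by eventually_elim (auto simp: kl_integrand_def split: if_splits)
      with False show False by simp
    qed
    moreover have "\<not> absolutely_continuous ?Q ?P"
    proof
      assume ac: "absolutely_continuous ?Q ?P"
      \<comment> \<open>\<open>?Q\<close> does not charge the set where \<open>g\<close> vanishes,
        so absolute continuity would force \<open>f = 0\<close> almost everywhere on it.\<close>
      have "AE x in ?Q. g x \<noteq> 0" by (auto simp: AE_density)
      then have "AE x in ?P. g x \<noteq> 0" by (intro absolutely_continuous_AE[OF _ ac]) auto
      then have "AE x in \<mu>. 0 < f x \<longrightarrow> g x \<noteq> 0" by (auto simp: AE_density)
      with fnn have "AE x in \<mu>. g x = 0 \<longrightarrow> f x = 0" by eventually_elim auto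
      with False show False by simp
    qed
    ultimately show ?thesis by (simp add: kl_def)
  qed
qed

section \<open>Radon-Nikodym densities and nonnegativity of the divergence\<close>

text \<open>Since \<open>N\<close> is finite, the derivative is finite almost everywhere and agrees
  almost everywhere with a real function that is nonnegative at every point. Strict positivity,
  needed for logarithms, holds only \<open>N\<close>-almost everywhere.\<close>

lemma (in sigma_finite_measure) obtain_real_density:
  assumes "finite_measure N" and ac: "absolutely_continuous M N" and sets: "sets N = sets M"
  obtains D :: "'a \<Rightarrow> real" where "D \<in> borel_measurable M" "\<And>x. 0 \<le> D x" "N = density M D"
    "AE x in N. 0 < D x" "AE x in N. entropy_density b M N x = log b (D x)"
proof -
  obtain D where D: "D \<in> borel_measurable M" "AE x in M. RN_deriv M N x = ennreal (D x)"
      "AE x in N. 0 < D x" "\<And>x. 0 \<le> D x"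
    using real_RN_deriv[OF assms] by blast
  have "N = density M (RN_deriv M N)"
    by (rule density_RN_deriv[OF ac sets, symmetric])
  also have "\<dots> = density M D"
    using D by (intro density_cong) auto
  finally have N: "N = density M D" .
  have "AE x in N. RN_deriv M N x = ennreal (D x)"
    by (rule absolutely_continuous_AE[OF sets ac D(2)])
  then have "AE x in N. entropy_density b M N x = log b (D x)"
    by eventually_elim (simp add: entropy_density_def D(4))
  with D N show thesis by (intro that) auto
qed

text \<open>With \<open>Q\<close> itself as the reference measure, \<open>P\<close> has a density
  \<open>D\<close> and \<open>Q\<close> the density \<open>1\<close>, and \<open>kl_density\<close>
  writes the divergence as the integral of a nonnegative function. Without absolute continuity the
  value is \<open>\<infinity>\<close>.\<close>

lemma kl_nonneg:
  assumes b: "1 < b" and "prob_space P" "prob_space Q" "sets P = sets Q"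
  shows "0 \<le> kl b P Q"
proof (cases "absolutely_continuous Q P")
  case True
  interpret P: prob_space P by fact
  interpret Q: prob_space Q by fact
  obtain D :: "_ \<Rightarrow> real" where D: "D \<in> borel_measurable Q" "\<And>x. 0 \<le> D x" and P: "P = density Q D"
    using Q.obtain_real_density[OF P.finite_measure_axioms True assms(4)] by blast
  have "prob_density Q D" using D assms(2) P by (intro prob_densityI) auto
  moreover have "prob_density Q (\<lambda>x. 1)"
    using Q.emeasure_space_1 by (simp add: prob_density_def)
  ultimately have "kl b (density Q D) (density Q (\<lambda>x. ennreal 1)) \<ge> 0"
    by (subst kl_density[OF b]) auto
  then show ?thesis unfolding P[symmetric] by (simp add: density_1)
qed (simp add: kl_def)

section \<open>Lower bounds for extended integrals\<close>

lemma ext_integral_mono_AE: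
  assumes "AE x in N. f x \<le> g x"
  shows "ext_integral N f \<le> ext_integral N g"
  unfolding ext_integral_def
proof (intro ereal_minus_mono)
  show "enn2ereal (\<integral>\<^sup>+ x. e2ennreal (f x) \<partial>N) \<le> enn2ereal (\<integral>\<^sup>+ x. e2ennreal (g x) \<partial>N)"
    unfolding less_eq_ennreal.rep_eq[symmetric]
    by (rule nn_integral_mono_AE, rule eventually_mono[OF assms]) (simp add: e2ennreal_mono)
  show "enn2ereal (\<integral>\<^sup>+ x. e2ennreal (- g x) \<partial>N) \<le> enn2ereal (\<integral>\<^sup>+ x. e2ennreal (- f x) \<partial>N)"
    unfolding less_eq_ennreal.rep_eq[symmetric]
    by (rule nn_integral_mono_AE, rule eventually_mono[OF assms]) (simp add: e2ennreal_mono)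
qed

text \<open>\<open>(u + k)\<^sup>+ + u\<^sup>- = u\<^sup>+ + k + (u + k)\<^sup>-\<close>, arranged so that no subtraction of \<open>ennreal\<close>s occurs.\<close>

lemma e2ennreal_split:
  fixes u :: real and k :: ennreal
  shows "e2ennreal (ereal u + enn2ereal k) + ennreal (- u) =
    ennreal u + k + e2ennreal (- (ereal u + enn2ereal k))"
proof (cases k)
  case (real r)
  have "ennreal (u + r) + ennreal (- u) = ennreal u + ennreal r + ennreal (- (u + r))"
  proof -
    consider "0 \<le> u" | "u < 0" "0 \<le> u + r" | "u < 0" "u + r < 0" by linarith
    then show ?thesis
    proof cases
      case 1 then show ?thesis using real by (simp add: ennreal_neg)
    next
      case 2 then show ?thesis using real by (simp add: ennreal_neg flip: ennreal_plus)
    next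
      case 3
      then have "ennreal r + ennreal (- (u + r)) = ennreal (-u)"
        using real by (subst ennreal_plus[symmetric]) auto
      then show ?thesis using 3 by (simp add: ennreal_neg)
    qed
  qed
  then show ?thesis using real by (simp add: enn2ereal_ennreal e2ennreal_ereal)
next
  case top
  then show ?thesis by simp
qed

text \<open>The minorant consists of an integrable real part \<open>u\<close> and a nonnegative part
  \<open>k\<close> whose integral may be infinite. Its negative part is dominated by that of
  \<open>u\<close>, so its extended integral is never \<open>\<infinity> - \<infinity>\<close> and
  is additive. The function \<open>g\<close>, later the loss integrand, enters only through
  monotonicity.\<close>

lemma le_ext_integral:
  assumes u: "integrable N u" and k[measurable]: "k \<in> borel_measurable N"
    and le: "AE x in N. ereal (u x) + enn2ereal (k x) \<le> g x"
  shows "ereal (\<integral>x. u x \<partial>N) + enn2ereal (\<integral>\<^sup>+ x. k x \<partial>N) \<le> ext_integral N g"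
proof -
  let ?v = "\<lambda>x. ereal (u x) + enn2ereal (k x)"
  note [measurable] = borel_measurable_integrable[OF u]
  let ?p = "\<integral>\<^sup>+ x. e2ennreal (?v x) \<partial>N" and ?n = "\<integral>\<^sup>+ x. e2ennreal (- ?v x) \<partial>N"
    and ?up = "\<integral>\<^sup>+ x. ennreal (u x) \<partial>N" and ?un = "\<integral>\<^sup>+ x. ennreal (- u x) \<partial>N"
    and ?k = "\<integral>\<^sup>+ x. k x \<partial>N"
  have eq: "?p + ?un = ?up + ?k + ?n"
  proof -
    have "?p + ?un = (\<integral>\<^sup>+ x. e2ennreal (?v x) + ennreal (- u x) \<partial>N)"
      by (intro nn_integral_add[symmetric]) measurable
    also have "\<dots> = (\<integral>\<^sup>+ x. ennreal (u x) + k x + e2ennreal (- ?v x) \<partial>N)"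
      by (simp only: e2ennreal_split)
    also have "\<dots> = ?up + ?k + ?n"
      by (simp add: nn_integral_add)
    finally show ?thesis .
  qed
  have fin: "?up < \<infinity>" "?un < \<infinity>"
    using integrableD(2,3)[OF u] by (auto simp: less_top)
  have "?n \<le> ?un"
  proof (intro nn_integral_mono)
    fix x
    have "- ?v x \<le> ereal (- u x)" by (cases "k x") (auto simp: enn2ereal_ennreal)
    from e2ennreal_mono[OF this] show "e2ennreal (- ?v x) \<le> ennreal (- u x)" by simp
  qed
  then have nfin: "?n < \<infinity>" using fin by auto
  have int: "(\<integral>x. u x \<partial>N) = enn2real ?up - enn2real ?un"
    by (rule real_lebesgue_integral_def[OF u])
  obtain a c d where acd: "?up = ennreal a" "?un = ennreal c" "?n = ennreal d" "0 \<le> a" "0 \<le> c" "0 \<le> d"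
    using fin nfin by (cases ?up; cases ?un; cases ?n) auto
  have "ereal (\<integral>x. u x \<partial>N) + enn2ereal ?k \<le> ext_integral N ?v"
  proof (cases ?k)
    case (real r)
    then have e: "?p + ennreal c = ennreal (a + r + d)" using eq acd by simp
    then obtain p where p: "?p = ennreal p" "0 \<le> p" by (cases ?p) auto
    with e acd real have "p + c = a + r + d" 
      by (simp flip: ennreal_plus)
    then show ?thesis unfolding ext_integral_def int using acd real p by (simp add: enn2ereal_ennreal)
  next
    case top
    \<comment> \<open>As \<open>?un\<close> is finite, an infinite integral of \<open>k\<close> can
      be balanced in \<open>eq\<close> only by \<open>?p\<close>.\<close>
    then have "?p = \<infinity>" using eq acd by auto
    then show ?thesis unfolding ext_integral_def using acd by simp
  qed
  also have "\<dots> \<le> ext_integral N g" using le by (rule ext_integral_mono_AE)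
  finally show ?thesis .
qed

section \<open>Conditional densities and the term \<open>I (Z; S)\<close>\<close>

text \<open>Joint measurability is stated for arbitrary compositions, the shape in which the
  measurability prover can use it as a raw rule.\<close>

lemma density_kernelD:
  assumes "density_kernel A C p"
  shows "\<And>N f g. f \<in> measurable N A \<Longrightarrow> g \<in> measurable N C \<Longrightarrow> (\<lambda>x. p (f x) (g x)) \<in> borel_measurable N"
    "\<And>s. s \<in> space A \<Longrightarrow> prob_density C (p s)"
    "\<And>s z. s \<in> space A \<Longrightarrow> z \<in> space C \<Longrightarrow> 0 \<le> p s z"
proof -
  fix N f g assume "f \<in> measurable N A" "g \<in> measurable N C"
  then have "(\<lambda>x. (f x, g x)) \<in> measurable N (A \<Otimes>\<^sub>M C)" by (rule measurable_Pair)
  from measurable_compose[OF this, of "\<lambda>(x, y). p x y" borel] assms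
  show "(\<lambda>x. p (f x) (g x)) \<in> borel_measurable N" by (simp add: density_kernel_def)
qed (use assms in \<open>auto simp: density_kernel_def prob_density_def\<close>)

text \<open>Compensation identity: if the right side is finite and \<open>m\<close>,
  \<open>q\<close> are positive, passing from the mean \<open>m\<close> to \<open>q\<close> raises
  the integral by exactly \<open>m log (m / q) + (q - m) / ln b\<close>, which is again a
  nonnegative divergence integrand.\<close>

lemma nn_integral_kl_integrand_mean_le:
  assumes b: "1 < b" and "prob_space N" and p[measurable]: "p \<in> borel_measurable N"
    and p_nonneg: "\<And>s. s \<in> space N \<Longrightarrow> 0 \<le> p s" and q: "0 \<le> q"
    and m: "(\<integral>\<^sup>+ s. ennreal (p s) \<partial>N) = ennreal m" "0 \<le> m"
  shows "(\<integral>\<^sup>+ s. kl_integrand b (p s) m \<partial>N) \<le> (\<integral>\<^sup>+ s. kl_integrand b (p s) q \<partial>N)"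
proof (cases "(\<integral>\<^sup>+ s. kl_integrand b (p s) q \<partial>N) = \<infinity>")
  case False
  interpret N: prob_space N by fact
  have nn: "AE s in N. 0 \<le> p s" using p_nonneg by (intro AE_I2)
  have int_p: "integrable N p" using nn m by (intro integrableI_nonneg) auto
  have mean: "(\<integral>s. p s \<partial>N) = m" using nn m by (subst integral_eq_nn_integral) auto
  \<comment> \<open>Finiteness of the right side forces \<open>p = 0\<close> almost everywhere when
    \<open>q = 0\<close>, so \<open>q\<close> is positive once the mean is.\<close>
  have fin: "AE s in N. q = 0 \<longrightarrow> p s = 0"
    using nn_integral_PInf_AE[OF _ False] by (auto simp: kl_integrand_def split: if_splits elim: eventually_mono)
  show ?thesis
  proof (cases "m = 0")
    case True
    then have "AE s in N. p s = 0"
      using m nn by (simp add: nn_integral_0_iff_AE) (elim AE_mp, auto)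
    then have "(\<integral>\<^sup>+ s. kl_integrand b (p s) m \<partial>N) = (\<integral>\<^sup>+ s. 0 \<partial>N)"
      using True by (intro nn_integral_cong_AE) (auto simp: kl_integrand_def)
    then show ?thesis by simp
  next
    case False
    then have "0 < m" using m by simp
    have "q \<noteq> 0"
    proof
      assume "q = 0"
      then have "AE s in N. p s = 0" using fin by simp
      then have "(\<integral>s. p s \<partial>N) = (\<integral>s. 0 \<partial>N)" by (intro integral_cong_AE) auto
      then show False using mean \<open>0 < m\<close> by simp
    qed
    then have "0 < q" using q by simp
    let ?D = "\<lambda>m s. p s * log b (p s / m) + (m - p s) / ln b"
    \<comment> \<open>\<open>?L\<close> is the difference of the integrands for \<open>q\<close> and
      \<open>m\<close>. It is affine in \<open>p s\<close>, hence integrable, so integrability of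
      \<open>?D m\<close> follows from that of \<open>?D q\<close>.\<close>
    let ?L = "\<lambda>s. p s * log b (m / q) + (q - m) / ln b"
    have I: "(\<integral>\<^sup>+ s. kl_integrand b (p s) r \<partial>N) = (\<integral>\<^sup>+ s. ennreal (?D r s) \<partial>N)"
      "AE s in N. 0 \<le> ?D r s" if "0 < r" for r
      using that kl_integrand_real_nonneg[OF b, of _ r] p_nonneg
      by (auto simp: kl_integrand_def intro!: nn_integral_cong)
    have diff: "?D m s = ?D q s - ?L s" if "s \<in> space N" for s
    proof (cases "p s = 0")
      case False
      then have "0 < p s" using p_nonneg[OF that] by simp
      then show ?thesis using \<open>0 < m\<close> \<open>0 < q\<close> b
        by (simp add: log_divide algebra_simps diff_divide_distrib)
    qed (simp add: diff_divide_distrib)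
    have int_q: "integrable N (?D q)"
      using \<open>(\<integral>\<^sup>+ s. kl_integrand b (p s) q \<partial>N) \<noteq> \<infinity>\<close> I[OF \<open>0 < q\<close>]
      by (intro integrableI_nonneg) (auto simp: less_top)
    have int_L: "integrable N ?L" using int_p by simp
    have int_m: "integrable N (?D m)"
      by (subst Bochner_Integration.integrable_cong[OF refl diff]) (use int_q int_L in auto)
    have "0 \<le> m * log b (m / q) + (q - m) / ln b"
      using kl_integrand_real_nonneg[OF b, of m q] \<open>0 < m\<close> \<open>0 < q\<close> by simp
    also have "\<dots> = (\<integral>s. ?L s \<partial>N)"
      using int_p mean by (simp add: N.prob_space)
    finally have "0 \<le> (\<integral>s. ?L s \<partial>N)" .
    moreover have "(\<integral>s. ?D m s \<partial>N) = (\<integral>s. ?D q s \<partial>N) - (\<integral>s. ?L s \<partial>N)"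
      by (subst Bochner_Integration.integral_diff[OF int_q int_L, symmetric])
        (rule Bochner_Integration.integral_cong[OF refl diff])
    ultimately have "(\<integral>s. ?D m s \<partial>N) \<le> (\<integral>s. ?D q s \<partial>N)" by linarith
    then show ?thesis
      unfolding I(1)[OF \<open>0 < m\<close>] I(1)[OF \<open>0 < q\<close>]
        nn_integral_eq_integral[OF int_m I(2)[OF \<open>0 < m\<close>]]
        nn_integral_eq_integral[OF int_q I(2)[OF \<open>0 < q\<close>]]
      by (rule ennreal_leI)
  qed
qed simp

text \<open>Relative to the product of \<open>C\<close> and the law of \<open>S\<close>, the joint
  law has density \<open>p s z\<close> and the product of the marginals has density
  \<open>r z\<close>, the marginal density of \<open>Z\<close>. Hence \<open>I (Z; S)\<close> is a
  double integral of \<open>kl_integrand\<close>, in which \<open>r z\<close> can be compared with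
  \<open>q z\<close> for almost every \<open>z\<close> separately.\<close>

lemma mutual_info_le_nn_integral_kl_integrand:
  assumes b: "1 < b" and "prob_space M" and C: "sigma_finite_measure C"
    and S[measurable]: "S \<in> measurable M A" and Z[measurable]: "Z \<in> measurable M C"
    and cd: "has_cond_density M A C S Z p" and q: "prob_density C q"
  shows "mutual_info b M C A Z S \<le>
    enn2ereal (\<integral>\<^sup>+ s. (\<integral>\<^sup>+ z. kl_integrand b (p s z) (q z) \<partial>C) \<partial>distr M A S)"
proof -
  interpret M: prob_space M by fact
  interpret C: sigma_finite_measure C by fact
  let ?PS = "distr M A S" and ?PZ = "distr M C Z"
  interpret PS: prob_space ?PS by (rule M.prob_space_distr) fact
  interpret PZ: prob_space ?PZ by (rule M.prob_space_distr) fact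
  interpret CS: pair_sigma_finite C ?PS ..
  interpret SC: pair_sigma_finite ?PS C ..
  have k: "density_kernel A C p"
    and joint: "distr M (A \<Otimes>\<^sub>M C) (\<lambda>\<omega>. (S \<omega>, Z \<omega>)) = density (?PS \<Otimes>\<^sub>M C) (\<lambda>(s, z). ennreal (p s z))"
    using cd by (auto simp: has_cond_density_def)
  note [measurable (raw)] = density_kernelD(1)[OF k]
  note [measurable] = prob_densityD(1)[OF q]
  have pm[measurable]: "(\<lambda>s. p s z) \<in> borel_measurable A" if "z \<in> space C" for z
    using that by measurable
  \<comment> \<open>The kernel describes the law of \<open>(S, Z)\<close>; Tonelli gives integrals
    over the reversed pair with \<open>z\<close> outermost, the order needed for a comparison at
    fixed \<open>z\<close>.\<close>
  have swap: "integral\<^sup>N (distr M (C \<Otimes>\<^sub>M A) (\<lambda>\<omega>. (Z \<omega>, S \<omega>))) h =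
      (\<integral>\<^sup>+ z. \<integral>\<^sup>+ s. ennreal (p s z) * h (z, s) \<partial>?PS \<partial>C)"
    if [measurable]: "h \<in> borel_measurable (C \<Otimes>\<^sub>M A)" for h :: "_ \<Rightarrow> ennreal"
  proof -
    have [measurable]: "(\<lambda>x. h (snd x, fst x)) \<in> borel_measurable (A \<Otimes>\<^sub>M C)"
      by measurable
    have "integral\<^sup>N (distr M (C \<Otimes>\<^sub>M A) (\<lambda>\<omega>. (Z \<omega>, S \<omega>))) h = (\<integral>\<^sup>+ \<omega>. h (Z \<omega>, S \<omega>) \<partial>M)"
      by (simp add: nn_integral_distr)
    also have "\<dots> = (\<integral>\<^sup>+ x. h (snd x, fst x) \<partial>distr M (A \<Otimes>\<^sub>M C) (\<lambda>\<omega>. (S \<omega>, Z \<omega>)))"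
      by (subst nn_integral_distr) auto
    also have "\<dots> = (\<integral>\<^sup>+ x. ennreal (p (fst x) (snd x)) * h (snd x, fst x) \<partial>(?PS \<Otimes>\<^sub>M C))"
      unfolding joint by (subst nn_integral_density) (auto simp: case_prod_beta')
    also have "\<dots> = (\<integral>\<^sup>+ z. \<integral>\<^sup>+ s. ennreal (p s z) * h (z, s) \<partial>?PS \<partial>C)"
      by (subst SC.nn_integral_snd[symmetric]) auto
    finally show ?thesis .
  qed
  define m where "m z = (\<integral>\<^sup>+ s. ennreal (p s z) \<partial>?PS)" for z
  have m[measurable]: "m \<in> borel_measurable C" unfolding m_def by measurable
  have PZ: "?PZ = density C m"
  proof (rule measure_eqI)
    fix D assume "D \<in> sets ?PZ"
    then have [measurable]: "D \<in> sets C" by simp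
    have "emeasure ?PZ D = integral\<^sup>N (distr M (C \<Otimes>\<^sub>M A) (\<lambda>\<omega>. (Z \<omega>, S \<omega>))) (\<lambda>x. indicator D (fst x))"
    proof -
      have "emeasure ?PZ D = (\<integral>\<^sup>+ z. indicator D z \<partial>?PZ)" by simp
      also have "\<dots> = (\<integral>\<^sup>+ \<omega>. indicator D (Z \<omega>) \<partial>M)" by (subst nn_integral_distr) auto
      also have "\<dots> = integral\<^sup>N (distr M (C \<Otimes>\<^sub>M A) (\<lambda>\<omega>. (Z \<omega>, S \<omega>))) (\<lambda>x. indicator D (fst x))"
        by (subst nn_integral_distr) auto
      finally show ?thesis .
    qed
    also have "\<dots> = (\<integral>\<^sup>+ z. m z * indicator D z \<partial>C)"
      unfolding m_def by (subst swap) (auto intro!: nn_integral_cong simp: nn_integral_multc)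
    finally show "emeasure ?PZ D = emeasure (density C m) D"
      by (simp add: emeasure_density)
  qed simp
  have m1: "(\<integral>\<^sup>+ z. m z \<partial>C) = 1"
    using PZ.emeasure_space_1 unfolding PZ by (simp add: emeasure_density cong: nn_integral_cong)
  then have mfin: "AE z in C. m z \<noteq> \<infinity>"
    by (intro nn_integral_PInf_AE) auto
  \<comment> \<open>\<open>m\<close> integrates to \<open>1\<close>, so it is finite almost
    everywhere and its real version \<open>r\<close> still represents the law of
    \<open>Z\<close>.\<close>
  define r where "r z = enn2real (m z)" for z
  have [measurable]: "r \<in> borel_measurable C" unfolding r_def by measurable
  have rm: "AE z in C. ennreal (r z) = m z"
    using mfin by eventually_elim (simp add: r_def less_top)
  have PZ_r: "?PZ = density C (\<lambda>z. ennreal (r z))"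
    unfolding PZ using rm by (intro density_cong) auto
  let ?\<mu> = "C \<Otimes>\<^sub>M ?PS"
  have "?PZ \<Otimes>\<^sub>M ?PS = density C (\<lambda>z. ennreal (r z)) \<Otimes>\<^sub>M density ?PS (\<lambda>s. 1)"
    unfolding PZ_r by (simp add: density_1)
  also have "\<dots> = density ?\<mu> (\<lambda>x. ennreal (r (fst x)))"
    by (subst pair_measure_density) (auto simp: density_1 case_prod_beta' PS.sigma_finite_measure_axioms)
  finally have prod: "?PZ \<Otimes>\<^sub>M ?PS = density ?\<mu> (\<lambda>x. ennreal (r (fst x)))" .
  have J: "distr M (C \<Otimes>\<^sub>M A) (\<lambda>\<omega>. (Z \<omega>, S \<omega>)) = density ?\<mu> (\<lambda>x. ennreal (p (snd x) (fst x)))"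
  proof (rule measure_eqI)
    fix D assume "D \<in> sets (distr M (C \<Otimes>\<^sub>M A) (\<lambda>\<omega>. (Z \<omega>, S \<omega>)))"
    then have [measurable]: "D \<in> sets (C \<Otimes>\<^sub>M A)" by simp
    have "emeasure (distr M (C \<Otimes>\<^sub>M A) (\<lambda>\<omega>. (Z \<omega>, S \<omega>))) D =
        integral\<^sup>N (distr M (C \<Otimes>\<^sub>M A) (\<lambda>\<omega>. (Z \<omega>, S \<omega>))) (indicator D)" by simp
    also have "\<dots> = (\<integral>\<^sup>+ x. ennreal (p (snd x) (fst x)) * indicator D x \<partial>?\<mu>)"
      by (subst swap) (auto simp: PS.nn_integral_fst[symmetric])
    finally show "emeasure (distr M (C \<Otimes>\<^sub>M A) (\<lambda>\<omega>. (Z \<omega>, S \<omega>))) D =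
        emeasure (density ?\<mu> (\<lambda>x. ennreal (p (snd x) (fst x)))) D"
      by (simp add: emeasure_density)
  qed simp
  have "prob_space (distr M (C \<Otimes>\<^sub>M A) (\<lambda>\<omega>. (Z \<omega>, S \<omega>)))"
    by (rule M.prob_space_distr) simp
  then have "prob_density ?\<mu> (\<lambda>x. p (snd x) (fst x))"
    unfolding J by (rule prob_densityI[rotated 2]) (auto simp: space_pair_measure intro: density_kernelD(3)[OF k])
  moreover have "prob_space (?PZ \<Otimes>\<^sub>M ?PS)"
    by (intro prob_space_pair) unfold_locales
  then have "prob_density ?\<mu> (\<lambda>x. r (fst x))"
    unfolding prod by (rule prob_densityI[rotated 2]) (auto simp: r_def)
  ultimately have "mutual_info b M C A Z S =
      enn2ereal (\<integral>\<^sup>+ x. kl_integrand b (p (snd x) (fst x)) (r (fst x)) \<partial>?\<mu>)"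
    unfolding mutual_info_def J prod by (rule kl_density[OF b])
  also have "(\<integral>\<^sup>+ x. kl_integrand b (p (snd x) (fst x)) (r (fst x)) \<partial>?\<mu>) =
      (\<integral>\<^sup>+ z. \<integral>\<^sup>+ s. kl_integrand b (p s z) (r z) \<partial>?PS \<partial>C)"
    by (subst PS.nn_integral_fst[symmetric]) auto
  also have "\<dots> \<le> (\<integral>\<^sup>+ z. \<integral>\<^sup>+ s. kl_integrand b (p s z) (q z) \<partial>?PS \<partial>C)"
  proof (rule nn_integral_mono_AE)
    show "AE z in C. (\<integral>\<^sup>+ s. kl_integrand b (p s z) (r z) \<partial>?PS) \<le> (\<integral>\<^sup>+ s. kl_integrand b (p s z) (q z) \<partial>?PS)"
      using rm prob_densityD(2)[OF q] AE_space
    proof eventually_elim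
      case (elim z)
      then show ?case
        using density_kernelD(3)[OF k] PS.prob_space_axioms pm[OF elim(3)]
        by (intro nn_integral_kl_integrand_mean_le[OF b]) (auto simp: m_def r_def)
    qed
  qed
  also have "(\<integral>\<^sup>+ z. \<integral>\<^sup>+ s. kl_integrand b (p s z) (q z) \<partial>?PS \<partial>C) =
      (\<integral>\<^sup>+ s. \<integral>\<^sup>+ z. kl_integrand b (p s z) (q z) \<partial>C \<partial>?PS)"
    by (rule CS.Fubini'[symmetric]) measurable
  finally show ?thesis by (simp add: less_eq_ennreal.rep_eq)
qed

section \<open>The Markov property as a disintegration\<close>

lemma subalgebra_vimage_algebra:
  "f \<in> measurable M N \<Longrightarrow> subalgebra M (vimage_algebra (space M) f N)"
  unfolding subalgebra_def by (auto simp: sets_vimage_algebra2 measurable_space)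

text \<open>By the joint law of \<open>(S, Z)\<close>, the mass that the kernel at \<open>S\<close>
  gives to \<open>D\<close> is a version of the conditional probability of \<open>Z \<in> D\<close>
  given \<open>S\<close>. The Markov property makes it a version given \<open>(Y, S)\<close> as
  well, so that it may be integrated over the event \<open>Y \<in> G\<close>.\<close>

lemma emeasure_markov_chain:
  assumes "prob_space M" and C: "sigma_finite_measure C"
    and S[measurable]: "S \<in> measurable M A" and Y[measurable]: "Y \<in> measurable M B"
    and Z[measurable]: "Z \<in> measurable M C"
    and markov: "markov_chain M B A C Y S Z" and cd: "has_cond_density M A C S Z p"
    and D[measurable]: "D \<in> sets C" and G[measurable]: "G \<in> sets B"
  shows "emeasure M (Y -` G \<inter> Z -` D \<inter> space M) =
    (\<integral>\<^sup>+ \<omega>. indicator G (Y \<omega>) * (\<integral>\<^sup>+ z. ennreal (p (S \<omega>) z) * indicator D z \<partial>C) \<partial>M)"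
proof -
  interpret M: prob_space M by fact
  interpret C: sigma_finite_measure C by fact
  let ?PS = "distr M A S"
  have k: "density_kernel A C p"
    and joint: "distr M (A \<Otimes>\<^sub>M C) (\<lambda>\<omega>. (S \<omega>, Z \<omega>)) = density (?PS \<Otimes>\<^sub>M C) (\<lambda>(s, z). ennreal (p s z))"
    using cd by (auto simp: has_cond_density_def)
  note [measurable (raw)] = density_kernelD(1)[OF k]
  define I :: "_ \<Rightarrow> real" where "I = indicator (Z -` D \<inter> space M)"
  define \<kappa> where "\<kappa> s = (\<integral>\<^sup>+ z. ennreal (p s z) * indicator D z \<partial>C)" for s
  define F1 where "F1 = vimage_algebra (space M) S A"
  define F2 where "F2 = vimage_algebra (space M) (\<lambda>\<omega>. (Y \<omega>, S \<omega>)) (B \<Otimes>\<^sub>M A)"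
  have I[measurable]: "I \<in> borel_measurable M" unfolding I_def by measurable
  have \<kappa>[measurable]: "\<kappa> \<in> borel_measurable A" unfolding \<kappa>_def by measurable
  have \<kappa>1: "\<kappa> s \<le> 1" if "s \<in> space A" for s
  proof -
    have "\<kappa> s \<le> (\<integral>\<^sup>+ z. ennreal (p s z) \<partial>C)"
      unfolding \<kappa>_def by (intro nn_integral_mono) (auto simp: indicator_def)
    also have "\<dots> = 1" using density_kernelD(2)[OF k that] by (simp add: prob_density_def)
    finally show ?thesis .
  qed
  define K where "K \<omega> = enn2real (\<kappa> (S \<omega>))" for \<omega>
  have K[measurable]: "K \<in> borel_measurable M" unfolding K_def by measurable
  have K_eq: "ennreal (K \<omega>) = \<kappa> (S \<omega>)" if "\<omega> \<in> space M" for \<omega>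
    using \<kappa>1[OF measurable_space[OF S that]] unfolding K_def
    by (intro ennreal_enn2real) (auto intro: le_less_trans)
  have K1: "K \<omega> \<le> 1" if "\<omega> \<in> space M" for \<omega>
    using \<kappa>1[OF measurable_space[OF S that]] K_eq[OF that] by (metis ennreal_le_1)
  have K0: "0 \<le> K \<omega>" for \<omega> by (simp add: K_def)
  have int_I: "integrable M I" unfolding I_def by (simp add: M.emeasure_eq_measure)
  have int_K: "integrable M K"
    using K1 K0 by (intro M.integrable_const_bound[where B=1]) auto
  interpret F1: finite_measure_subalgebra M F1
    unfolding F1_def by unfold_locales (rule subalgebra_vimage_algebra[OF S])
  interpret F2: finite_measure_subalgebra M F2
    unfolding F2_def by unfold_locales (rule subalgebra_vimage_algebra, measurable)
  have set_int_K: "(\<integral>\<omega>\<in>E. K \<omega> \<partial>M) = enn2real (\<integral>\<^sup>+ \<omega>. indicator E \<omega> * \<kappa> (S \<omega>) \<partial>M)"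
    if [measurable]: "E \<in> sets M" for E
  proof -
    have "(\<integral>\<^sup>+ \<omega>. indicator E \<omega> * \<kappa> (S \<omega>) \<partial>M) = (\<integral>\<^sup>+ \<omega>. ennreal (indicator E \<omega> * K \<omega>) \<partial>M)"
      by (intro nn_integral_cong) (simp add: K_eq indicator_def)
    then show ?thesis
      unfolding set_lebesgue_integral_def
      by (simp add: integral_eq_nn_integral K0)
  qed
  have set_int_I: "(\<integral>\<omega>\<in>E. I \<omega> \<partial>M) = measure M (E \<inter> Z -` D \<inter> space M)"
    if [measurable]: "E \<in> sets M" for E
  proof -
    have "(\<integral>\<omega>\<in>E. I \<omega> \<partial>M) = (\<integral>\<omega>. indicator (E \<inter> Z -` D \<inter> space M) \<omega> \<partial>M)"
      unfolding set_lebesgue_integral_def I_def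
      by (intro Bochner_Integration.integral_cong) (auto simp: indicator_def)
    also have "\<dots> = measure M (E \<inter> Z -` D \<inter> space M)" by (simp add: Int_assoc)
    finally show ?thesis .
  qed
  have "AE \<omega> in M. real_cond_exp M F1 I \<omega> = K \<omega>"
  proof (rule F1.real_cond_exp_charact[OF _ int_I int_K])
    fix E assume "E \<in> sets F1"
    then obtain F where F[measurable]: "F \<in> sets A" and E: "E = S -` F \<inter> space M"
      unfolding F1_def using measurable_space[OF S] by (auto simp: sets_vimage_algebra2)
    have [measurable]: "E \<in> sets M" unfolding E by measurable
    have "emeasure M (E \<inter> Z -` D \<inter> space M) = emeasure (distr M (A \<Otimes>\<^sub>M C) (\<lambda>\<omega>. (S \<omega>, Z \<omega>))) (F \<times> D)"
      unfolding E by (subst emeasure_distr) (auto intro!: arg_cong[where f="emeasure M"])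
    also have "\<dots> = (\<integral>\<^sup>+ s. \<integral>\<^sup>+ z. ennreal (p s z) * indicator (F \<times> D) (s, z) \<partial>C \<partial>?PS)"
      unfolding joint by (simp add: emeasure_density case_prod_beta' C.nn_integral_fst[symmetric])
    also have "\<dots> = (\<integral>\<^sup>+ s. indicator F s * \<kappa> s \<partial>?PS)"
      unfolding \<kappa>_def by (intro nn_integral_cong) (auto simp: indicator_def)
    also have "\<dots> = (\<integral>\<^sup>+ \<omega>. indicator E \<omega> * \<kappa> (S \<omega>) \<partial>M)"
      by (subst nn_integral_distr) (auto simp: E indicator_def intro!: nn_integral_cong)
    finally show "(\<integral>\<omega>\<in>E. I \<omega> \<partial>M) = (\<integral>\<omega>\<in>E. K \<omega> \<partial>M)"
      by (simp add: set_int_I set_int_K measure_def)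
  next
    have "S \<in> measurable F1 A"
      unfolding F1_def using measurable_space[OF S] by (intro measurable_vimage_algebra1) auto
    then show "K \<in> borel_measurable F1" unfolding K_def by measurable
  qed
  moreover have "AE \<omega> in M. real_cond_exp M F2 I \<omega> = real_cond_exp M F1 I \<omega>"
    using markov D by (auto simp: markov_chain_def F1_def F2_def I_def)
  ultimately have ae: "AE \<omega> in M. real_cond_exp M F2 I \<omega> = K \<omega>"
    by eventually_elim simp
  let ?E = "Y -` G \<inter> space M"
  have E[measurable]: "?E \<in> sets M" by measurable
  \<comment> \<open>The event \<open>Y \<in> G\<close> lies in the algebra of \<open>(Y, S)\<close>,
    as the preimage of a rectangle with full second side, but in general not in that of
    \<open>S\<close>; this is where the Markov property is used.\<close>
  have "?E = (\<lambda>\<omega>. (Y \<omega>, S \<omega>)) -` (G \<times> space A) \<inter> space M"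
    using measurable_space[OF S] by auto
  also have "\<dots> \<in> sets F2" unfolding F2_def by (intro in_vimage_algebra) measurable
  finally have EF: "?E \<in> sets F2" .
  have "measure M (?E \<inter> Z -` D \<inter> space M) = (\<integral>\<omega>\<in>?E. real_cond_exp M F2 I \<omega> \<partial>M)"
    using F2.real_cond_exp_intA[OF int_I EF] set_int_I[OF E] by simp
  also have "\<dots> = (\<integral>\<omega>\<in>?E. K \<omega> \<partial>M)"
    unfolding set_lebesgue_integral_def using ae
    by (intro integral_cong_AE) auto
  also have "\<dots> = enn2real (\<integral>\<^sup>+ \<omega>. indicator ?E \<omega> * \<kappa> (S \<omega>) \<partial>M)"
    by (rule set_int_K[OF E])
  finally have meas: "measure M (?E \<inter> Z -` D \<inter> space M) = \<dots>" .
  \<comment> \<open>The bound by \<open>1\<close> allows the passage back from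
    \<open>enn2real\<close> to the \<open>ennreal\<close> integral.\<close>
  have "(\<integral>\<^sup>+ \<omega>. indicator ?E \<omega> * \<kappa> (S \<omega>) \<partial>M) \<le> (\<integral>\<^sup>+ \<omega>. 1 \<partial>M)"
    using \<kappa>1 measurable_space[OF S] by (intro nn_integral_mono) (auto simp: indicator_def)
  then have "(\<integral>\<^sup>+ \<omega>. indicator ?E \<omega> * \<kappa> (S \<omega>) \<partial>M) < \<top>"
    by (auto simp: M.emeasure_space_1 intro: le_less_trans)
  then have "emeasure M (?E \<inter> Z -` D \<inter> space M) = (\<integral>\<^sup>+ \<omega>. indicator ?E \<omega> * \<kappa> (S \<omega>) \<partial>M)"
    by (simp add: M.emeasure_eq_measure meas ennreal_enn2real)
  moreover have "(\<integral>\<^sup>+ \<omega>. indicator ?E \<omega> * \<kappa> (S \<omega>) \<partial>M) = (\<integral>\<^sup>+ \<omega>. indicator G (Y \<omega>) * \<kappa> (S \<omega>) \<partial>M)"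
    by (intro nn_integral_cong) (auto simp: indicator_def)
  moreover have "?E \<inter> Z -` D \<inter> space M = Y -` G \<inter> Z -` D \<inter> space M" by auto
  ultimately show ?thesis by (simp add: \<kappa>_def)
qed

text \<open>Drawing \<open>(s, y)\<close> from the law of \<open>(S, Y)\<close> and then
  \<open>z\<close> from \<open>p s\<close> reproduces the law of \<open>(Z, Y)\<close>: the two laws
  agree on rectangles by \<open>emeasure_markov_chain\<close>, and rectangles form an
  intersection-stable generator.\<close>

lemma nn_integral_markov_chain:
  assumes "prob_space M" and C: "sigma_finite_measure C"
    and S[measurable]: "S \<in> measurable M A" and Y[measurable]: "Y \<in> measurable M B"
    and Z[measurable]: "Z \<in> measurable M C"
    and markov: "markov_chain M B A C Y S Z" and cd: "has_cond_density M A C S Z p"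
    and F[measurable]: "F \<in> borel_measurable (C \<Otimes>\<^sub>M B)"
  shows "(\<integral>\<^sup>+ x. F x \<partial>distr M (C \<Otimes>\<^sub>M B) (\<lambda>\<omega>. (Z \<omega>, Y \<omega>))) =
    (\<integral>\<^sup>+ x. (\<integral>\<^sup>+ z. F (z, snd x) \<partial>density C (\<lambda>z. ennreal (p (fst x) z))) \<partial>distr M (A \<Otimes>\<^sub>M B) (\<lambda>\<omega>. (S \<omega>, Y \<omega>)))"
proof -
  interpret M: prob_space M by fact
  interpret C: sigma_finite_measure C by fact
  let ?J = "distr M (A \<Otimes>\<^sub>M B) (\<lambda>\<omega>. (S \<omega>, Y \<omega>))"
  let ?P = "distr M (C \<Otimes>\<^sub>M B) (\<lambda>\<omega>. (Z \<omega>, Y \<omega>))"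
  have k: "density_kernel A C p" using cd by (auto simp: has_cond_density_def)
  note [measurable (raw)] = density_kernelD(1)[OF k]
  \<comment> \<open>\<open>?N\<close> is the law of \<open>((s, y), z)\<close> under this two-stage
    drawing, and \<open>?K\<close> is its image on the pairs \<open>(z, y)\<close>.\<close>
  let ?N = "density (?J \<Otimes>\<^sub>M C) (\<lambda>x. ennreal (p (fst (fst x)) (snd x)))"
  let ?K = "distr ?N (C \<Otimes>\<^sub>M B) (\<lambda>x. (snd x, snd (fst x)))"
  have pm: "p s \<in> borel_measurable C" if "s \<in> space A" for s
    using density_kernelD(2)[OF k that] by (rule prob_densityD)
  have nn_K: "(\<integral>\<^sup>+ x. H x \<partial>?K) =
    (\<integral>\<^sup>+ x. (\<integral>\<^sup>+ z. H (z, snd x) \<partial>density C (\<lambda>z. ennreal (p (fst x) z))) \<partial>?J)"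
    if [measurable]: "H \<in> borel_measurable (C \<Otimes>\<^sub>M B)" for H
  proof -
    have "(\<integral>\<^sup>+ x. H x \<partial>?K) = (\<integral>\<^sup>+ x. ennreal (p (fst (fst x)) (snd x)) * H (snd x, snd (fst x)) \<partial>(?J \<Otimes>\<^sub>M C))"
      by (subst nn_integral_distr, measurable, subst nn_integral_density, measurable)
    also have "\<dots> = (\<integral>\<^sup>+ x. (\<integral>\<^sup>+ z. ennreal (p (fst x) z) * H (z, snd x) \<partial>C) \<partial>?J)"
      by (subst C.nn_integral_fst[symmetric]) auto
    also have "\<dots> = (\<integral>\<^sup>+ x. (\<integral>\<^sup>+ z. H (z, snd x) \<partial>density C (\<lambda>z. ennreal (p (fst x) z))) \<partial>?J)"
    proof (intro nn_integral_cong)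
      fix x assume "x \<in> space ?J"
      then have x: "fst x \<in> space A" "snd x \<in> space B" by (auto simp: space_pair_measure)
      note [measurable] = pm[OF x(1)]
      have [measurable]: "(\<lambda>z. H (z, snd x)) \<in> borel_measurable C" using x by measurable
      show "(\<integral>\<^sup>+ z. ennreal (p (fst x) z) * H (z, snd x) \<partial>C) =
        (\<integral>\<^sup>+ z. H (z, snd x) \<partial>density C (\<lambda>z. ennreal (p (fst x) z)))"
        by (subst nn_integral_density) auto
    qed
    finally show ?thesis .
  qed
  have "?P = ?K"
  proof (rule measure_eqI_generator_eq[OF Int_stable_pair_measure_generator[of C B], where A="\<lambda>_. space C \<times> space B"])
    show "{a \<times> b |a b. a \<in> sets C \<and> b \<in> sets B} \<subseteq> Pow (space C \<times> space B)"
      using sets.space_closed[of C] sets.space_closed[of B] by auto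
    show "sets ?P = sigma_sets (space C \<times> space B) {a \<times> b |a b. a \<in> sets C \<and> b \<in> sets B}"
      by (simp add: sets_pair_measure)
    show "sets ?K = sigma_sets (space C \<times> space B) {a \<times> b |a b. a \<in> sets C \<and> b \<in> sets B}"
      by (simp add: sets_pair_measure)
    show "range (\<lambda>_. space C \<times> space B) \<subseteq> {a \<times> b |a b. a \<in> sets C \<and> b \<in> sets B}"
      by auto
    have "prob_space ?P" by (rule M.prob_space_distr) simp
    then show "emeasure ?P (space C \<times> space B) \<noteq> \<infinity>" for i :: nat
      using prob_space.emeasure_space_1[of ?P] by (simp add: space_pair_measure)
  next
    fix X assume "X \<in> {a \<times> b |a b. a \<in> sets C \<and> b \<in> sets B}"
    then obtain D G where X: "X = D \<times> G" and [measurable]: "D \<in> sets C" "G \<in> sets B" by auto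
    have "emeasure ?P X = emeasure M (Y -` G \<inter> Z -` D \<inter> space M)"
      unfolding X by (subst emeasure_distr) (auto intro!: arg_cong[where f="emeasure M"])
    also have "\<dots> = (\<integral>\<^sup>+ \<omega>. indicator G (Y \<omega>) * (\<integral>\<^sup>+ z. ennreal (p (S \<omega>) z) * indicator D z \<partial>C) \<partial>M)"
      by (rule emeasure_markov_chain[OF assms(1-7)]) auto
    also have "\<dots> = (\<integral>\<^sup>+ x. indicator G (snd x) * (\<integral>\<^sup>+ z. ennreal (p (fst x) z) * indicator D z \<partial>C) \<partial>?J)"
      by (subst nn_integral_distr) auto
    also have "\<dots> = (\<integral>\<^sup>+ x. (\<integral>\<^sup>+ z. indicator X (z, snd x) \<partial>density C (\<lambda>z. ennreal (p (fst x) z))) \<partial>?J)"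
    proof (intro nn_integral_cong)
      fix x assume "x \<in> space ?J"
      then have x: "fst x \<in> space A" "snd x \<in> space B" by (auto simp: space_pair_measure)
      note [measurable] = pm[OF x(1)]
      have e: "indicator X (z, snd x) = (indicator G (snd x) * indicator D z :: ennreal)" for z
        by (auto simp: X indicator_def)
      show "indicator G (snd x) * (\<integral>\<^sup>+ z. ennreal (p (fst x) z) * indicator D z \<partial>C) =
        (\<integral>\<^sup>+ z. indicator X (z, snd x) \<partial>density C (\<lambda>z. ennreal (p (fst x) z)))"
        unfolding e by (simp add: nn_integral_cmult nn_integral_density emeasure_density)
    qed
    also have "\<dots> = (\<integral>\<^sup>+ x. indicator X x \<partial>?K)"
      by (rule nn_K[symmetric]) (simp add: X)
    also have "\<dots> = emeasure ?K X" by (rule nn_integral_indicator) (simp add: X)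
    finally show "emeasure ?P X = emeasure ?K X" .
  qed auto
  then show ?thesis using nn_K[OF F] by simp
qed

section \<open>Reduction to an integrable minorant of the log loss\<close>

text \<open>Integrating \<open>U\<close> over the kernel gives an integrable function
  \<open>u\<close> of \<open>(s, y)\<close>. The loss integrand is at least \<open>u\<close> plus
  \<open>\<beta>\<close> times the divergence at \<open>s\<close>, a sum to which
  \<open>le_ext_integral\<close> applies; the second summand integrates to at least
  \<open>\<beta> I (Z; S)\<close>.\<close>

lemma le_VIB_loss:
  assumes b: "1 < b" and \<beta>: "0 \<le> \<beta>" and "prob_space M" and C: "sigma_finite_measure C"
    and S[measurable]: "S \<in> measurable M A" and Y[measurable]: "Y \<in> measurable M B"
    and Z[measurable]: "Z \<in> measurable M C"
    and markov: "markov_chain M B A C Y S Z" and cd: "has_cond_density M A C S Z p"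
    and q: "prob_density C q"
    and U: "integrable (distr M (C \<Otimes>\<^sub>M B) (\<lambda>\<omega>. (Z \<omega>, Y \<omega>))) U"
    and U_le: "\<And>z y. z \<in> space C \<Longrightarrow> y \<in> space B \<Longrightarrow> ereal (U (z, y)) \<le> neg_log b (r z y)"
  shows "ereal (\<integral>x. U x \<partial>distr M (C \<Otimes>\<^sub>M B) (\<lambda>\<omega>. (Z \<omega>, Y \<omega>)))
      + ereal \<beta> * mutual_info b M C A Z S \<le> VIB_loss b M A B C S Y \<beta> p q r"
proof -
  interpret M: prob_space M by fact
  interpret C: sigma_finite_measure C by fact
  let ?P = "distr M (C \<Otimes>\<^sub>M B) (\<lambda>\<omega>. (Z \<omega>, Y \<omega>))"
  let ?J = "distr M (A \<Otimes>\<^sub>M B) (\<lambda>\<omega>. (S \<omega>, Y \<omega>))"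
  let ?\<kappa> = "\<lambda>s. density C (\<lambda>z. ennreal (p s z))"
  have k: "density_kernel A C p" using cd by (auto simp: has_cond_density_def)
  note [measurable (raw)] = density_kernelD(1)[OF k]
  note [measurable] = prob_densityD(1)[OF q]
  have [measurable]: "U \<in> borel_measurable (C \<Otimes>\<^sub>M B)"
    using borel_measurable_integrable[OF U] by simp
  have pm: "p s \<in> borel_measurable C" if "s \<in> space A" for s
    using density_kernelD(2)[OF k that] by (rule prob_densityD)
  \<comment> \<open>The inner integral of \<open>U\<close> may fail to exist on a null set of
    \<open>(s, y)\<close>, so its two parts are kept as \<open>ennreal\<close> integrals and related
    to the Bochner integral only where they are finite.\<close>
  define pos where "pos x = (\<integral>\<^sup>+ z. ennreal (U (z, snd x)) \<partial>?\<kappa> (fst x))" for x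
  define neg where "neg x = (\<integral>\<^sup>+ z. ennreal (- U (z, snd x)) \<partial>?\<kappa> (fst x))" for x
  have meas: "(\<lambda>x. \<integral>\<^sup>+ z. F (z, snd x) \<partial>?\<kappa> (fst x)) \<in> borel_measurable ?J"
    if [measurable]: "F \<in> borel_measurable (C \<Otimes>\<^sub>M B)" for F :: "_ \<Rightarrow> ennreal"
  proof -
    have "(\<lambda>x. \<integral>\<^sup>+ z. ennreal (p (fst x) z) * F (z, snd x) \<partial>C) \<in> borel_measurable (A \<Otimes>\<^sub>M B)"
      by measurable
    moreover have "(\<integral>\<^sup>+ z. F (z, snd x) \<partial>?\<kappa> (fst x)) = (\<integral>\<^sup>+ z. ennreal (p (fst x) z) * F (z, snd x) \<partial>C)"
      if "x \<in> space (A \<Otimes>\<^sub>M B)" for x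
    proof -
      have x: "fst x \<in> space A" "snd x \<in> space B" using that by (auto simp: space_pair_measure)
      note [measurable] = pm[OF x(1)]
      have "(\<lambda>z. F (z, snd x)) \<in> borel_measurable C" using x by measurable
      then show ?thesis by (subst nn_integral_density) auto
    qed
    ultimately have "(\<lambda>x. \<integral>\<^sup>+ z. F (z, snd x) \<partial>?\<kappa> (fst x)) \<in> borel_measurable (A \<Otimes>\<^sub>M B)"
      by (subst measurable_cong)
    then show ?thesis by simp
  qed
  have [measurable]: "pos \<in> borel_measurable ?J" "neg \<in> borel_measurable ?J"
    unfolding pos_def neg_def by (rule meas; measurable)+
  have int_pos: "(\<integral>\<^sup>+ x. pos x \<partial>?J) = (\<integral>\<^sup>+ x. ennreal (U x) \<partial>?P)"
    unfolding pos_def by (rule nn_integral_markov_chain[OF assms(3-9), symmetric]) measurable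
  have int_neg: "(\<integral>\<^sup>+ x. neg x \<partial>?J) = (\<integral>\<^sup>+ x. ennreal (- U x) \<partial>?P)"
    unfolding neg_def by (rule nn_integral_markov_chain[OF assms(3-9), symmetric]) measurable
  have fin: "(\<integral>\<^sup>+ x. pos x \<partial>?J) \<noteq> \<infinity>" "(\<integral>\<^sup>+ x. neg x \<partial>?J) \<noteq> \<infinity>"
    unfolding int_pos int_neg using U by (auto dest: integrableD)
  have ae_pos: "AE x in ?J. pos x \<noteq> \<infinity>" by (rule nn_integral_PInf_AE[OF _ fin(1)]) simp
  have ae_neg: "AE x in ?J. neg x \<noteq> \<infinity>" by (rule nn_integral_PInf_AE[OF _ fin(2)]) simp
  have enn: "integrable ?J (\<lambda>x. enn2real (f x)) \<and> (\<integral>x. enn2real (f x) \<partial>?J) = enn2real (\<integral>\<^sup>+ x. f x \<partial>?J)"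
    if [measurable]: "f \<in> borel_measurable ?J" and ae: "AE x in ?J. f x \<noteq> \<infinity>"
      and fin: "(\<integral>\<^sup>+ x. f x \<partial>?J) \<noteq> \<infinity>" for f :: "_ \<Rightarrow> ennreal"
  proof -
    have eq: "(\<integral>\<^sup>+ x. ennreal (enn2real (f x)) \<partial>?J) = (\<integral>\<^sup>+ x. f x \<partial>?J)"
      using ae by (intro nn_integral_cong_AE) (auto simp: less_top)
    have "integrable ?J (\<lambda>x. enn2real (f x))"
      using fin eq by (intro integrableI_nonneg) (auto simp: less_top)
    moreover have "(\<integral>x. enn2real (f x) \<partial>?J) = enn2real (\<integral>\<^sup>+ x. f x \<partial>?J)"
      by (subst integral_eq_nn_integral) (simp_all only: eq, auto)
    ultimately show ?thesis ..
  qed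
  define u where "u x = enn2real (pos x) - enn2real (neg x)" for x
  have "integrable ?J (\<lambda>x. enn2real (pos x)) \<and> (\<integral>x. enn2real (pos x) \<partial>?J) = enn2real (\<integral>\<^sup>+ x. pos x \<partial>?J)"
    using ae_pos fin by (intro enn) auto
  moreover have "integrable ?J (\<lambda>x. enn2real (neg x)) \<and> (\<integral>x. enn2real (neg x) \<partial>?J) = enn2real (\<integral>\<^sup>+ x. neg x \<partial>?J)"
    using ae_neg fin by (intro enn) auto
  ultimately have u: "integrable ?J u" and int_u: "(\<integral>x. u x \<partial>?J) = (\<integral>x. U x \<partial>?P)"
    unfolding u_def by (auto simp: real_lebesgue_integral_def[OF U] int_pos int_neg)
  define K where "K s = (\<integral>\<^sup>+ z. kl_integrand b (p s z) (q z) \<partial>C)" for s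
  have K[measurable]: "K \<in> borel_measurable A" unfolding K_def by measurable
  have \<beta>_mult: "ereal \<beta> * enn2ereal t = enn2ereal (ennreal \<beta> * t)" for t
    using \<beta> by (simp add: times_ennreal.rep_eq)
  let ?g = "\<lambda>(s, y). ext_integral (?\<kappa> s) (\<lambda>z. neg_log b (r z y)) + ereal \<beta> * kl b (?\<kappa> s) (density C (\<lambda>z. ennreal (q z)))"
  have le: "AE x in ?J. ereal (u x) + enn2ereal (ennreal \<beta> * K (fst x)) \<le> ?g x"
    using ae_pos ae_neg AE_space
  proof eventually_elim
    case (elim x)
    then have x: "fst x \<in> space A" "snd x \<in> space B" by (auto simp: space_pair_measure)
    note [measurable] = pm[OF x(1)]
    have "(\<lambda>z. U (z, snd x)) \<in> borel_measurable C" using x by measurable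
    then have Ux: "integrable (?\<kappa> (fst x)) (\<lambda>z. U (z, snd x))"
      using elim by (auto simp: real_integrable_def pos_def neg_def)
    have "ereal (\<integral>z. U (z, snd x) \<partial>?\<kappa> (fst x)) + enn2ereal (\<integral>\<^sup>+ z. 0 \<partial>?\<kappa> (fst x))
        \<le> ext_integral (?\<kappa> (fst x)) (\<lambda>z. neg_log b (r z (snd x)))"
      using U_le x by (intro le_ext_integral Ux AE_I2) (auto simp: zero_ennreal.rep_eq)
    then have "ereal (u x) \<le> ext_integral (?\<kappa> (fst x)) (\<lambda>z. neg_log b (r z (snd x)))"
      by (simp add: real_lebesgue_integral_def[OF Ux] u_def pos_def neg_def zero_ennreal.rep_eq)
    moreover have "kl b (?\<kappa> (fst x)) (density C (\<lambda>z. ennreal (q z))) = enn2ereal (K (fst x))"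
      unfolding K_def by (rule kl_density[OF b density_kernelD(2)[OF k x(1)] q])
    ultimately show ?case by (auto simp: case_prod_beta' \<beta>_mult intro: add_right_mono)
  qed
  have "mutual_info b M C A Z S \<le> enn2ereal (\<integral>\<^sup>+ s. K s \<partial>distr M A S)"
    unfolding K_def by (rule mutual_info_le_nn_integral_kl_integrand[OF b assms(3,4,5,7,9,10)])
  then have "ereal \<beta> * mutual_info b M C A Z S \<le> ereal \<beta> * enn2ereal (\<integral>\<^sup>+ s. K s \<partial>distr M A S)"
    using \<beta> by (intro ereal_mult_left_mono) auto
  also have "\<dots> = enn2ereal (\<integral>\<^sup>+ x. ennreal \<beta> * K (fst x) \<partial>?J)"
    unfolding \<beta>_mult by (simp add: nn_integral_cmult nn_integral_distr)
  finally have "ereal (\<integral>x. U x \<partial>?P) + ereal \<beta> * mutual_info b M C A Z S \<le>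
      ereal (\<integral>x. u x \<partial>?J) + enn2ereal (\<integral>\<^sup>+ x. ennreal \<beta> * K (fst x) \<partial>?J)"
    unfolding int_u by (rule add_left_mono)
  also have "\<dots> \<le> ext_integral ?J ?g"
    by (rule le_ext_integral[OF u _ le]) measurable
  finally show ?thesis by (simp add: VIB_loss_def)
qed

section \<open>The minorant behind the cross-entropy bound\<close>

text \<open>The assumptions on \<open>H (Y)\<close> and \<open>I (Z; Y)\<close> make
  \<open>log g\<close> and \<open>log h\<close> integrable under the joint law, where they
  contribute \<open>H (Y) - I (Z; Y)\<close>. It remains to see that the ratio
  \<open>r / (g h)\<close> has integral at most \<open>1\<close>.\<close>

lemma cross_entropy_minorant:
  assumes b: "1 < b" and "prob_space M" and \<nu>: "sigma_finite_measure \<nu>"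
    and Y[measurable]: "Y \<in> measurable M \<nu>" and Z[measurable]: "Z \<in> measurable M C"
    and ac_Y: "absolutely_continuous \<nu> (distr M \<nu> Y)"
    and ent: "integrable (distr M \<nu> Y) (entropy_density b \<nu> (distr M \<nu> Y))"
    and fin: "mutual_info b M C \<nu> Z Y < \<infinity>" and kernel: "density_kernel C \<nu> r"
  obtains U i where "integrable (distr M (C \<Otimes>\<^sub>M \<nu>) (\<lambda>\<omega>. (Z \<omega>, Y \<omega>))) U"
    and "mutual_info b M C \<nu> Z Y = ereal i"
    and "prob_space.entropy M b \<nu> Y - i \<le> (\<integral>x. U x \<partial>distr M (C \<Otimes>\<^sub>M \<nu>) (\<lambda>\<omega>. (Z \<omega>, Y \<omega>)))"
    and "\<And>z y. z \<in> space C \<Longrightarrow> y \<in> space \<nu> \<Longrightarrow> ereal (U (z, y)) \<le> neg_log b (r z y)"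
proof -
  interpret M: prob_space M by fact
  interpret \<nu>: sigma_finite_measure \<nu> by fact
  let ?PZ = "distr M C Z" and ?PY = "distr M \<nu> Y"
  let ?P = "distr M (C \<Otimes>\<^sub>M \<nu>) (\<lambda>\<omega>. (Z \<omega>, Y \<omega>))" and ?Q = "?PZ \<Otimes>\<^sub>M ?PY"
  interpret PZ: prob_space ?PZ by (rule M.prob_space_distr) fact
  interpret PY: prob_space ?PY by (rule M.prob_space_distr) fact
  interpret P: prob_space ?P by (rule M.prob_space_distr) simp
  interpret Q: prob_space ?Q by (intro prob_space_pair) unfold_locales
  have sets_P: "sets ?P = sets ?Q" by (simp cong: sets_pair_measure_cong)
  have ac: "absolutely_continuous ?Q ?P" and int_ent: "integrable ?P (entropy_density b ?Q ?P)"
    and mi: "mutual_info b M C \<nu> Z Y = ereal (KL_divergence b ?Q ?P)"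
    using fin by (auto simp: mutual_info_def kl_def split: if_splits)
  note [measurable (raw)] = density_kernelD(1)[OF kernel]
  obtain h :: "_ \<Rightarrow> real" where h: "h \<in> borel_measurable ?Q" "\<And>x. 0 \<le> h x" and P_eq: "?P = density ?Q h"
    and h_pos: "AE x in ?P. 0 < h x" and ent_h: "AE x in ?P. entropy_density b ?Q ?P x = log b (h x)"
    using Q.obtain_real_density[where b=b, OF P.finite_measure_axioms ac sets_P] by blast
  have h_meas[measurable]: "h \<in> borel_measurable (C \<Otimes>\<^sub>M \<nu>)" using h(1) by simp
  obtain g :: "_ \<Rightarrow> real" where g[measurable]: "g \<in> borel_measurable \<nu>" and g0: "\<And>y. 0 \<le> g y"
    and PY_eq: "?PY = density \<nu> g" and g_posY: "AE y in ?PY. 0 < g y"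
    and ent_g: "AE y in ?PY. entropy_density b \<nu> ?PY y = log b (g y)"
    using \<nu>.obtain_real_density[where b=b, OF PY.finite_measure_axioms ac_Y sets_distr] by blast
  \<comment> \<open>The law of \<open>Y\<close> is a marginal of \<open>?P\<close>, which transfers
    statements about \<open>g\<close> to the joint law.\<close>
  have PY_snd: "?PY = distr ?P \<nu> snd" by (subst distr_distr) (auto simp: comp_def)
  have g_pos: "AE x in ?P. 0 < g (snd x)"
    using g_posY unfolding PY_snd by (subst (asm) AE_distr_iff) auto
  have ed_meas: "entropy_density b ?Q ?P \<in> borel_measurable ?P"
    using measurable_entropy_density[of b ?Q ?P] by simp
  have int_h: "integrable ?P (\<lambda>x. log b (h x))"
    by (rule integrable_cong_AE_imp[OF int_ent]) (use ent_h in \<open>auto elim: eventually_mono\<close>)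
  have i_eq: "KL_divergence b ?Q ?P = (\<integral>x. log b (h x) \<partial>?P)"
    unfolding KL_divergence_def by (rule integral_cong_AE[OF ed_meas _ ent_h]) simp
  have int_gY: "integrable ?PY (\<lambda>y. log b (g y))"
    by (rule integrable_cong_AE_imp[OF ent]) (use ent_g in \<open>auto elim: eventually_mono\<close>)
  have H_eq: "M.entropy b \<nu> Y = - (\<integral>y. log b (g y) \<partial>?PY)"
    unfolding M.entropy_def KL_divergence_def by (subst integral_cong_AE[OF _ _ ent_g]) auto
  have int_g: "integrable ?P (\<lambda>x. log b (g (snd x)))"
    using int_gY unfolding PY_snd by (subst (asm) integrable_distr_eq) auto
  have int_g_eq: "(\<integral>y. log b (g y) \<partial>?PY) = (\<integral>x. log b (g (snd x)) \<partial>?P)"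
    unfolding PY_snd by (subst integral_distr) auto
  let ?T = "\<lambda>x. r (fst x) (snd x) / (g (snd x) * h x)"
  have T_nonneg: "0 \<le> ?T x" if "x \<in> space (C \<Otimes>\<^sub>M \<nu>)" for x
    using that density_kernelD(3)[OF kernel] g0 h(2) by (auto simp: space_pair_measure)
  \<comment> \<open>The densities \<open>h\<close> and \<open>g\<close> cancel wherever they are
    nonzero and contribute \<open>0\<close> elsewhere, so inequalities result; what is left is the
    mass \<open>1\<close> of \<open>r z\<close>, averaged over the law of \<open>Z\<close>.\<close>
  have "(\<integral>\<^sup>+ x. ennreal (?T x) \<partial>?P) = (\<integral>\<^sup>+ x. ennreal (h x) * ennreal (?T x) \<partial>?Q)"
    unfolding P_eq by (subst nn_integral_density) (auto simp: h(1))
  also have "\<dots> \<le> (\<integral>\<^sup>+ x. ennreal (r (fst x) (snd x) / g (snd x)) \<partial>?Q)"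
  proof (rule nn_integral_mono)
    fix x assume "x \<in> space ?Q"
    then have "0 \<le> r (fst x) (snd x)"
      using density_kernelD(3)[OF kernel] by (auto simp: space_pair_measure)
    then show "ennreal (h x) * ennreal (?T x) \<le> ennreal (r (fst x) (snd x) / g (snd x))"
      using h(2)[of x] g0[of "snd x"] by (cases "h x = 0") (auto simp: ennreal_mult'[symmetric])
  qed
  also have "\<dots> = (\<integral>\<^sup>+ z. \<integral>\<^sup>+ y. ennreal (r z y / g y) \<partial>?PY \<partial>?PZ)"
    by (subst PY.nn_integral_fst[symmetric]) auto
  also have "\<dots> \<le> (\<integral>\<^sup>+ z. 1 \<partial>?PZ)"
  proof (rule nn_integral_mono)
    fix z assume "z \<in> space ?PZ"
    then have z: "z \<in> space C" by simp
    note [measurable] = prob_densityD(1)[OF density_kernelD(2)[OF kernel z]]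
    have "(\<integral>\<^sup>+ y. ennreal (r z y / g y) \<partial>?PY) = (\<integral>\<^sup>+ y. ennreal (g y) * ennreal (r z y / g y) \<partial>\<nu>)"
      unfolding PY_eq by (subst nn_integral_density) auto
    also have "\<dots> \<le> (\<integral>\<^sup>+ y. ennreal (r z y) \<partial>\<nu>)"
    proof (rule nn_integral_mono)
      fix y assume "y \<in> space \<nu>"
      then show "ennreal (g y) * ennreal (r z y / g y) \<le> ennreal (r z y)"
        using g0[of y] density_kernelD(3)[OF kernel z]
        by (cases "g y = 0") (auto simp: ennreal_mult'[symmetric])
    qed
    also have "\<dots> = 1" using density_kernelD(2)[OF kernel z] by (simp add: prob_density_def)
    finally show "(\<integral>\<^sup>+ y. ennreal (r z y / g y) \<partial>?PY) \<le> 1" .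
  qed
  also have "\<dots> = 1" by (simp add: PZ.emeasure_space_1[simplified])
  finally have T_le: "(\<integral>\<^sup>+ x. ennreal (?T x) \<partial>?P) \<le> 1" .
  have T_ae: "AE x in ?P. 0 \<le> ?T x" using T_nonneg by (intro AE_I2) simp
  have int_T: "integrable ?P ?T"
    using T_ae T_le by (intro integrableI_nonneg) (auto intro: le_less_trans)
  have "(\<integral>x. ?T x \<partial>?P) \<le> 1"
    using T_le nn_integral_eq_integral[OF int_T T_ae] by simp
  then have T1: "0 \<le> (1 - (\<integral>x. ?T x \<partial>?P)) / ln b" using b by simp
  let ?V = "\<lambda>x. - log b (g (snd x)) - log b (h x) + (1 - ?T x) / ln b"
  \<comment> \<open>Outside a null set \<open>U\<close> is \<open>?V\<close>; the other branches make \<open>U \<le> - log r\<close> hold everywhere.\<close>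
  define U where "U x = (if 0 < g (snd x) \<and> 0 < h x then ?V x
    else if r (fst x) (snd x) = 0 then 0 else - log b (r (fst x) (snd x)))" for x
  have UV: "AE x in ?P. ?V x = U x"
    using g_pos h_pos by eventually_elim (simp add: U_def)
  have [measurable]: "U \<in> borel_measurable ?P" unfolding U_def by measurable
  have int_V: "integrable ?P ?V" using int_g int_h int_T by auto
  show thesis
  proof
    show "integrable ?P U" by (rule integrable_cong_AE_imp[OF int_V _ UV]) simp
    show "mutual_info b M C \<nu> Z Y = ereal (KL_divergence b ?Q ?P)" by (rule mi)
    have "M.entropy b \<nu> Y - KL_divergence b ?Q ?P \<le> (\<integral>x. ?V x \<partial>?P)"
      using int_g int_h int_T T1 by (simp add: H_eq i_eq int_g_eq P.prob_space[simplified])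
    also have "\<dots> = (\<integral>x. U x \<partial>?P)"
      using int_V by (intro integral_cong_AE UV) auto
    finally show "M.entropy b \<nu> Y - KL_divergence b ?Q ?P \<le> (\<integral>x. U x \<partial>?P)" .
  next
    fix z y assume "z \<in> space C" "y \<in> space \<nu>"
    then have r0: "0 \<le> r z y" by (rule density_kernelD(3)[OF kernel])
    show "ereal (U (z, y)) \<le> neg_log b (r z y)"
    \<comment> \<open>In the excluded cases either \<open>r z y = 0\<close>, where the right side is
      \<open>\<infinity>\<close>, or \<open>U\<close> is \<open>- log r\<close> by
      definition.\<close>
    proof (cases "0 < g y \<and> 0 < h (z, y) \<and> r z y \<noteq> 0")
      case True
      then have pos: "0 < g y" "0 < h (z, y)" "0 < r z y" using r0 by auto
      let ?t = "r z y / (g y * h (z, y))"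
      have "ln ?t \<le> ?t - 1" using pos by (intro ln_le_minus_one) simp
      then have "log b ?t \<le> (?t - 1) / ln b" using b by (simp add: log_def divide_right_mono)
      moreover have "log b ?t = log b (r z y) - log b (g y) - log b (h (z, y))"
        using pos by (simp add: log_divide log_mult)
      ultimately have "?V (z, y) \<le> - log b (r z y)" by (simp add: diff_divide_distrib)
      then show ?thesis using pos by (simp add: U_def neg_log_def)
    qed (auto simp: U_def neg_log_def)
  qed
qed

section \<open>The variational upper bound, with and without the entropy of \<open>Y\<close>\<close>

text \<open>For a general reference measure the constant \<open>H (Y)\<close> stays on the left: a
  differential entropy can be negative, and dropping it may then break the inequality, as for
  \<open>Y\<close> uniform on a short interval, independent of \<open>S\<close>, with exact
  \<open>q\<close> and \<open>q_phi\<close>. For a counting measure the bound holds without it, even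
  if \<open>H (Y)\<close> or a mutual information is infinite.\<close>

theorem mainTheorem1:
  fixes M :: "'w measure"
    and S :: "'w \<Rightarrow> real ^ 'n"
    and Y :: "'w \<Rightarrow> 'y"
    and Z :: "'w \<Rightarrow> complex ^ 'k"
    and \<nu> :: "'y measure"
    and p_theta :: "real ^ 'n \<Rightarrow> complex ^ 'k \<Rightarrow> real"
    and q :: "complex ^ 'k \<Rightarrow> real"
    and q_phi :: "complex ^ 'k \<Rightarrow> 'y \<Rightarrow> real"
    and \<beta> b :: real
  assumes "prob_space M"
    and "1 < b"
    and "0 \<le> \<beta>"
    and "S \<in> measurable M borel"
    and "Y \<in> measurable M \<nu>"
    and "Z \<in> measurable M lborel"
    and "sigma_finite_measure \<nu>"
    and "absolutely_continuous \<nu> (distr M \<nu> Y)"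
    and "markov_chain M \<nu> borel lborel Y S Z"
    and "has_cond_density M borel lborel S Z p_theta"
    and "prob_density lborel q"
    and "density_kernel lborel \<nu> q_phi"
  shows "(integrable (distr M \<nu> Y) (entropy_density b \<nu> (distr M \<nu> Y)) \<and>
          mutual_info b M lborel \<nu> Z Y < \<infinity> \<longrightarrow>
            IB_loss b M borel \<nu> lborel S Y Z \<beta> + ereal (prob_space.entropy M b \<nu> Y)
              \<le> VIB_loss b M borel \<nu> lborel S Y \<beta> p_theta q q_phi) \<and>
         ((\<exists>A. \<nu> = count_space A) \<longrightarrow>
            IB_loss b M borel \<nu> lborel S Y Z \<beta>
              \<le> VIB_loss b M borel \<nu> lborel S Y \<beta> p_theta q q_phi)"
proof (intro conjI impI)
  let ?P = "distr M (lborel \<Otimes>\<^sub>M \<nu>) (\<lambda>\<omega>. (Z \<omega>, Y \<omega>))"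
  let ?X = "ereal \<beta> * mutual_info b M lborel borel Z S"
  let ?R = "VIB_loss b M borel \<nu> lborel S Y \<beta> p_theta q q_phi"
  interpret M: prob_space M by fact
  have bound: "ereal (\<integral>x. U x \<partial>?P) + ?X \<le> ?R"
    if "integrable ?P U" "\<And>z y. z \<in> space lborel \<Longrightarrow> y \<in> space \<nu> \<Longrightarrow> ereal (U (z, y)) \<le> neg_log b (q_phi z y)" for U
    using assms that by (intro le_VIB_loss lborel.sigma_finite_measure_axioms)
  {
    assume fin: "integrable (distr M \<nu> Y) (entropy_density b \<nu> (distr M \<nu> Y)) \<and>
      mutual_info b M lborel \<nu> Z Y < \<infinity>"
    obtain U i where U: "integrable ?P U"
      and i: "mutual_info b M lborel \<nu> Z Y = ereal i"
      and le: "M.entropy b \<nu> Y - i \<le> (\<integral>x. U x \<partial>?P)"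
      and U_le: "\<And>z y. z \<in> space lborel \<Longrightarrow> y \<in> space \<nu> \<Longrightarrow> ereal (U (z, y)) \<le> neg_log b (q_phi z y)"
      using cross_entropy_minorant[OF assms(2,1,7,5,6,8) conjunct1[OF fin] conjunct2[OF fin] assms(12)] by blast
    \<comment> \<open>\<open>i\<close> is real, so the constants can be regrouped even if
      \<open>?X\<close> is infinite.\<close>
    have "IB_loss b M borel \<nu> lborel S Y Z \<beta> + ereal (M.entropy b \<nu> Y) = ereal (M.entropy b \<nu> Y - i) + ?X"
      unfolding IB_loss_def i by (cases ?X) auto
    also have "\<dots> \<le> ereal (\<integral>x. U x \<partial>?P) + ?X"
      using le by (intro add_right_mono) simp
    also have "\<dots> \<le> ?R" by (rule bound[OF U U_le])
    finally show "IB_loss b M borel \<nu> lborel S Y Z \<beta> + ereal (M.entropy b \<nu> Y) \<le> ?R" .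
  next
    assume "\<exists>A. \<nu> = count_space A"
    then obtain A where A: "\<nu> = count_space A" ..
    \<comment> \<open>A density with respect to counting measure is at most \<open>1\<close>, so its
      negative logarithm is nonnegative and \<open>0\<close> serves as the minorant.\<close>
    have nonneg: "0 \<le> neg_log b (q_phi z y)" if "y \<in> space \<nu>" for z y
    proof -
      have pd: "prob_density \<nu> (q_phi z)" using density_kernelD(2)[OF assms(12)] by simp
      have "ennreal (q_phi z y) \<le> (\<integral>\<^sup>+ y. ennreal (q_phi z y) \<partial>\<nu>)"
        using that unfolding A by (intro nn_integral_ge_point) simp
      also have "\<dots> = 1" using pd by (simp add: prob_density_def)
      finally have "q_phi z y \<le> 1" by simp
      moreover have "0 \<le> q_phi z y" using pd that by (simp add: prob_density_def)
      ultimately show ?thesis using \<open>1 < b\<close> by (auto simp: neg_log_def)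
    qed
    have mi: "0 \<le> mutual_info b M lborel \<nu> Z Y"
      unfolding mutual_info_def
    proof (rule kl_nonneg[OF \<open>1 < b\<close>])
      show "prob_space ?P" using assms by (intro M.prob_space_distr) simp
      show "prob_space (distr M lborel Z \<Otimes>\<^sub>M distr M \<nu> Y)"
        using assms by (intro prob_space_pair M.prob_space_distr)
    qed (simp cong: sets_pair_measure_cong)
    \<comment> \<open>Both mutual informations may be infinite here; only
      \<open>- I (Z; Y) \<le> 0\<close> and monotonicity of \<open>ereal\<close> addition
      enter.\<close>
    have "IB_loss b M borel \<nu> lborel S Y Z \<beta> \<le> 0 + ?X"
      unfolding IB_loss_def using mi by (intro add_right_mono) (simp add: ereal_uminus_le_reorder)
    also have "\<dots> = ereal (\<integral>x. 0 \<partial>?P) + ?X" by (simp add: zero_ereal_def)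
    also have "\<dots> \<le> ?R" using nonneg by (intro bound) (auto simp: zero_ereal_def[symmetric])
    finally show "IB_loss b M borel \<nu> lborel S Y Z \<beta> \<le> ?R" .
  }
qed

end
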